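(* Let $\mathcal{R}=(\mathbb{R},+,\cdot,0,1,<,\dots)$ be an o-minimal expansion of the real ordered field. Let $M$ be a $k$-cell in $\mathbb{R}^n$ (definable in $\mathcal{R}$), and let $f_1,\dots,f_k,g_1,\dots,g_k$ be $C^1$ real-valued functions on $M$ definable in $\mathcal{R}$. For $i\in[k]$ let $h_{i,0}$ denote $f_i$ and $h_{i,1}$ denote $g_i$. Suppose that: (a) for all $\tau\in 2^{[k]}$, the map $H_\tau=(h_{1,\tau(1)},\dots,h_{k,\tau(k)}):M\to\mathbb{R}^k$ is regular on $M$; (b) for all $\tau\in 2^{[k]}$, the map $H_\tau=(h_{1,\tau(1)},\dots,h_{k,\tau(k)}):M\to\mathbb{R}^k$ is proper; (c) for all $i\in[k]$, the sets $\{f_i=0\}$ and $\{g_i=0\}$ are connected; (d) for all $i\in[k]$, $\{f_i=0\}\cap\{g_i=0\}=\emptyset$. Then there exists a sequence $(\square_{i,\epsilon}:i\in[k],\epsilon\in\{0,1\})\in\{\leq,\geq\}^{[k]\times\{0,1\}}$ such that for all $J\subseteq[k]$ and all $\tau\in 2^{[k]}$, the enclosed region $$\bigcap_{i\in[k]\setminus J}\big(\{f_i\,\square_{i,0}\,0\}\cap\{g_i\,\square_{i,1}\,0\}\big)\cap\bigcap_{l\in J}\{h_{l,\tau(l)}=0\}$$ is compact. In particular, if $J=\emptyset$, then $\bigcap_{i\in[k]}\big(\{f_i\,\square_{i,0}\,0\}\cap\{g_i\,\square_{i,1}\,0\}\big)$ is compact.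
   Context: $[k]=\{1,\dots,k\}$, and $2^{[k]}$ is the set of functions $[k]\to\{0,1\}$. An o-minimal expansion of the real ordered field is an expansion $\mathcal{R}$ in which every subset of $\mathbb{R}$ definable (with parameters) is a finite union of points and intervals. A $k$-cell is a cell, in the sense of o-minimal cell decomposition, of dimension $k$. For a function $f$ on $M$ and $\square\in\{<,>,\leq,\geq,=\}$, $\{f\,\square\,0\}=\{x\in M: f(x)\,\square\,0\}$. A $C^1$ map is regular if its differential is surjective at every point. A map is proper if preimages of compact sets are compact. *)

theory Defs
  imports "HOL-Analysis.Analysis"
begin

text \<open>
  \<open>\<real>\<^sup>n\<close> is the set of sequences vanishing from index \<open>n\<close> on; coordinates are numbered from \<open>0\<close>.
  As a subspace of \<open>nat \<Rightarrow> real\<close> with the product topology it carries the usual topology, so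
  \<open>continuous_on\<close>, \<open>compact\<close> and \<open>connected\<close> have their usual meaning on its subsets.
\<close>

definition Rn :: "nat \<Rightarrow> (nat \<Rightarrow> real) set" where
  "Rn n = {x. \<forall>i\<ge>n. x i = 0}"

text \<open>
  An expansion is given by interpretations of arbitrary further function and relation symbols.
  Symbols carry no arity: the same symbol applied to argument lists of different lengths acts as
  different symbols. Every real number is available as a constant, so definability is with
  parameters (and \<open>0\<close>, \<open>1\<close> need no symbols of their own).
\<close>

record ('f, 'r) expansion =
  fun_interp :: "'f \<Rightarrow> real list \<Rightarrow> real"
  rel_interp :: "'r \<Rightarrow> real list \<Rightarrow> bool"

datatype 'f trm =
    Var nat
  | Par real
  | Plus "'f trm" "'f trm"
  | Times "'f trm" "'f trm"
  | Fun 'f "'f trm list"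

datatype ('f, 'r) fm =
    Equal "'f trm" "'f trm"
  | Less "'f trm" "'f trm"
  | Rel 'r "'f trm list"
  | Neg "('f, 'r) fm"
  | Conj "('f, 'r) fm" "('f, 'r) fm"
  | Ex nat "('f, 'r) fm"

primrec val :: "('f, 'r) expansion \<Rightarrow> (nat \<Rightarrow> real) \<Rightarrow> 'f trm \<Rightarrow> real" where
  "val R x (Var i) = x i"
| "val R x (Par c) = c"
| "val R x (Plus s t) = val R x s + val R x t"
| "val R x (Times s t) = val R x s * val R x t"
| "val R x (Fun F ts) = fun_interp R F (map (val R x) ts)"

primrec sat :: "('f, 'r) expansion \<Rightarrow> (nat \<Rightarrow> real) \<Rightarrow> ('f, 'r) fm \<Rightarrow> bool" where
  "sat R x (Equal s t) \<longleftrightarrow> val R x s = val R x t"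
| "sat R x (Less s t) \<longleftrightarrow> val R x s < val R x t"
| "sat R x (Rel P ts) \<longleftrightarrow> rel_interp R P (map (val R x) ts)"
| "sat R x (Neg \<phi>) \<longleftrightarrow> \<not> sat R x \<phi>"
| "sat R x (Conj \<phi> \<psi>) \<longleftrightarrow> sat R x \<phi> \<and> sat R x \<psi>"
| "sat R x (Ex i \<phi>) \<longleftrightarrow> (\<exists>a. sat R (x(i := a)) \<phi>)"

text \<open>For \<open>x \<in> Rn n\<close>, free variables of \<open>\<phi>\<close> with index \<open>\<ge> n\<close> just denote the parameter \<open>0\<close>.\<close>

definition definable_set :: "('f, 'r) expansion \<Rightarrow> nat \<Rightarrow> (nat \<Rightarrow> real) set \<Rightarrow> bool" where
  "definable_set R n A \<longleftrightarrow> (\<exists>\<phi>. A = {x \<in> Rn n. sat R x \<phi>})"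

definition definable_fun ::
    "('f, 'r) expansion \<Rightarrow> nat \<Rightarrow> (nat \<Rightarrow> real) set \<Rightarrow> ((nat \<Rightarrow> real) \<Rightarrow> real) \<Rightarrow> bool" where
  "definable_fun R n X f \<longleftrightarrow> X \<subseteq> Rn n \<and> definable_set R (Suc n) {x(n := f x) | x. x \<in> X}"

definition o_minimal :: "('f, 'r) expansion \<Rightarrow> bool" where
  "o_minimal R \<longleftrightarrow>
    (\<forall>A :: real set. definable_set R 1 {x \<in> Rn 1. x 0 \<in> A} \<longrightarrow>
      (\<exists>\<I>. finite \<I> \<and> (\<forall>I\<in>\<I>. (\<exists>a. I = {a}) \<or> is_interval I) \<and> A = \<Union>\<I>))"

text \<open>
  \<open>is_cell R \<sigma> M\<close>: \<open>M\<close> is an \<open>(i\<^sub>1, \<dots>, i\<^sub>n)\<close>-cell in \<open>\<real>\<^sup>n\<close>, where \<open>n = length \<sigma>\<close> and \<open>\<sigma>\<close> lists the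
  \<open>i\<^sub>j \<in> {0, 1}\<close> (\<open>True\<close> for \<open>1\<close>). In a band, \<open>None\<close> as lower or upper bound stands for the constant
  \<open>-\<infinity>\<close> or \<open>+\<infinity>\<close>.
\<close>

definition admissible_bound ::
    "('f, 'r) expansion \<Rightarrow> nat \<Rightarrow> (nat \<Rightarrow> real) set \<Rightarrow> ((nat \<Rightarrow> real) \<Rightarrow> real) option \<Rightarrow> bool" where
  "admissible_bound R n X b \<longleftrightarrow>
    (\<forall>\<alpha>. b = Some \<alpha> \<longrightarrow> definable_fun R n X \<alpha> \<and> continuous_on X \<alpha>)"

inductive is_cell :: "('f, 'r) expansion \<Rightarrow> bool list \<Rightarrow> (nat \<Rightarrow> real) set \<Rightarrow> bool"
  for R where
  point: "is_cell R [] (Rn 0)"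
| graph: "is_cell R (\<sigma> @ [False]) {x(length \<sigma> := \<alpha> x) | x. x \<in> X}"
    if "is_cell R \<sigma> X" "definable_fun R (length \<sigma>) X \<alpha>" "continuous_on X \<alpha>"
| band: "is_cell R (\<sigma> @ [True])
      {x(length \<sigma> := t) | x t. x \<in> X \<and> (\<forall>\<alpha>. lo = Some \<alpha> \<longrightarrow> \<alpha> x < t) \<and> (\<forall>\<beta>. up = Some \<beta> \<longrightarrow> t < \<beta> x)}"
    if "is_cell R \<sigma> X" "admissible_bound R (length \<sigma>) X lo" "admissible_bound R (length \<sigma>) X up"
      "\<forall>\<alpha> \<beta>. lo = Some \<alpha> \<and> up = Some \<beta> \<longrightarrow> (\<forall>x\<in>X. \<alpha> x < \<beta> x)"

text \<open>
  The coordinate projection of a \<open>k\<close>-cell to the \<open>k\<close> coordinates \<open>j\<close> with \<open>i\<^sub>j = 1\<close> is a homeomorphism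
  onto an open cell in \<open>\<real>\<^sup>k\<close>. This global chart is the differentiable structure of the cell; if the
  cell is a \<open>C\<^sup>1\<close> cell it is the one inherited as a submanifold of \<open>\<real>\<^sup>n\<close>, and if \<open>k = n\<close> it is the
  identity. A \<open>k\<close>-cell is presented by a labelling \<open>e\<close> of these coordinates by a type \<open>'k\<close> with \<open>k\<close>
  elements; permuting the labels affects none of the notions below.
\<close>

definition free_coords :: "bool list \<Rightarrow> nat set" where
  "free_coords \<sigma> = {j. j < length \<sigma> \<and> \<sigma> ! j}"

definition k_cell ::
    "('f, 'r) expansion \<Rightarrow> nat \<Rightarrow> ('k::finite \<Rightarrow> nat) \<Rightarrow> (nat \<Rightarrow> real) set \<Rightarrow> bool" where
  "k_cell R n e M \<longleftrightarrow> (\<exists>\<sigma>. is_cell R \<sigma> M \<and> length \<sigma> = n \<and> bij_betw e UNIV (free_coords \<sigma>))"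

definition chart :: "('k::finite \<Rightarrow> nat) \<Rightarrow> (nat \<Rightarrow> real) \<Rightarrow> real ^ 'k" where
  "chart e x = (\<chi> a. x (e a))"

definition in_chart ::
    "('k::finite \<Rightarrow> nat) \<Rightarrow> (nat \<Rightarrow> real) set \<Rightarrow> ((nat \<Rightarrow> real) \<Rightarrow> 'b) \<Rightarrow> real ^ 'k \<Rightarrow> 'b" where
  "in_chart e M h = h \<circ> inv_into M (chart e)"

definition C1_on_cell ::
    "('k::finite \<Rightarrow> nat) \<Rightarrow> (nat \<Rightarrow> real) set \<Rightarrow> ((nat \<Rightarrow> real) \<Rightarrow> 'b::real_normed_vector) \<Rightarrow> bool" where
  "C1_on_cell e M h \<longleftrightarrow>
    (\<exists>D :: real ^ 'k \<Rightarrow> (real ^ 'k) \<Rightarrow>\<^sub>L 'b.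
      (\<forall>u \<in> chart e ` M. (in_chart e M h has_derivative blinfun_apply (D u)) (at u)) \<and>
      continuous_on (chart e ` M) D)"

definition regular_on_cell ::
    "('k::finite \<Rightarrow> nat) \<Rightarrow> (nat \<Rightarrow> real) set \<Rightarrow> ((nat \<Rightarrow> real) \<Rightarrow> 'b::real_normed_vector) \<Rightarrow> bool" where
  "regular_on_cell e M H \<longleftrightarrow>
    C1_on_cell e M H \<and> (\<forall>u \<in> chart e ` M. surj (frechet_derivative (in_chart e M H) (at u)))"

definition proper_on ::
    "'a::topological_space set \<Rightarrow> ('a \<Rightarrow> 'b::topological_space) \<Rightarrow> bool" where
  "proper_on M H \<longleftrightarrow> (\<forall>K. compact K \<longrightarrow> compact {x \<in> M. H x \<in> K})"

text \<open>The index \<open>\<epsilon> \<in> {0, 1}\<close> is a Boolean, with \<open>False\<close> for \<open>0\<close> (so \<open>h\<^sub>i\<^sub>,\<^sub>0 = f\<^sub>i\<close>).\<close>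

definition h_fun :: "('k \<Rightarrow> 'a \<Rightarrow> real) \<Rightarrow> ('k \<Rightarrow> 'a \<Rightarrow> real) \<Rightarrow> 'k \<Rightarrow> bool \<Rightarrow> 'a \<Rightarrow> real" where
  "h_fun f g i \<epsilon> = (if \<epsilon> then g i else f i)"

definition H_map ::
    "('k::finite \<Rightarrow> 'a \<Rightarrow> real) \<Rightarrow> ('k \<Rightarrow> 'a \<Rightarrow> real) \<Rightarrow> ('k \<Rightarrow> bool) \<Rightarrow> 'a \<Rightarrow> real ^ 'k" where
  "H_map f g \<tau> x = (\<chi> i. h_fun f g i (\<tau> i) x)"

end

theory Submission
  imports Defs
begin

text \<open>
  A cell is homeomorphic to a connected open subset of \<open>\<real>\<^sup>k\<close>, so each proper regular map \<open>H\<^sub>\<tau>\<close> is a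
  covering of the simply connected space \<open>\<real>\<^sup>k\<close> by a connected space, hence a homeomorphism (Hadamard).

  By (c) and (d), \<open>f\<^sub>i\<close> has constant sign on \<open>{g\<^sub>i = 0}\<close> and vice versa; choose the inequalities so that
  these signs are allowed. Compactness of the regions follows by induction on \<open>k - |J|\<close>. In the slice
  \<open>{h\<^sub>l = 0, l \<in> J}\<close>, identified with \<open>\<real>\<^sup>m\<close> by \<open>H\<^sub>\<tau>\<close>, the frontier of the region lies in a union of
  regions with larger \<open>J\<close>, which is compact. If \<open>m \<ge> 2\<close>, the complement of a large ball is
  connected, so it is contained in the region or disjoint from it, and the former is impossible
  because each \<open>h\<^sub>i\<close> takes both signs there. If \<open>m = 1\<close>, the region is the segment between the zeros
  of the monotone functions \<open>f\<^sub>i\<close> and \<open>g\<^sub>i\<close>.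
\<close>

section \<open>Global inversion of proper local homeomorphisms\<close>

section \<open>Proper local homeomorphisms\<close>

text \<open>Properness makes the fibres compact and local injectivity makes them discrete, so they
  are finite. Disjoint small neighbourhoods of the fibre points have open images around the base
  point; a neighbourhood inside all these images, shrunk so that nothing else maps into it, is
  evenly covered.\<close>

lemma proper_local_homeomorphism_imp_covering_space:
  fixes p :: "'a::heine_borel \<Rightarrow> 'b::{real_normed_vector, heine_borel}"
  assumes contp: "continuous_on U p" and ne: "U \<noteq> {}"
    and local: "\<And>x. x \<in> U \<Longrightarrow> \<exists>A. open A \<and> A \<subseteq> U \<and> x \<in> A \<and> (\<exists>V q. open V \<and> homeomorphism A V p q)"
    and proper: "\<And>K. compact K \<Longrightarrow> compact (U \<inter> p -` K)"
  shows "covering_space U p UNIV"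
proof -
  have opU: "open U"
    by (subst open_subopen) (use local in blast)
  have openmap: "open (p ` W)" if "open W" "W \<subseteq> U" for W
  proof (subst open_subopen, safe)
    fix x assume "x \<in> W"
    then have "x \<in> U" using that by blast
    then obtain A V q where A: "open A" "A \<subseteq> U" "x \<in> A" "open V" "homeomorphism A V p q"
      using local by metis
    have "openin (top_of_set V) (p ` (A \<inter> W))"
      by (rule homeomorphism_imp_open_map [OF A(5)])
        (use A \<open>open W\<close> in \<open>simp add: openin_open_eq open_Int\<close>)
    then have "open (p ` (A \<inter> W))"
      using A(4) openin_open_eq by blast
    then show "\<exists>T. open T \<and> p x \<in> T \<and> T \<subseteq> p ` W"
      using A(3) \<open>x \<in> W\<close> by (intro exI [of _ "p ` (A \<inter> W)"]) auto
  qed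
  have closedmap: "closed (p ` C)" if "closedin (top_of_set U) C" for C
  proof -
    have "closedin (top_of_set UNIV) (p ` C)"
      by (rule proper_map [OF that]) (use proper in auto)
    then show ?thesis by simp
  qed
  have "closed (p ` U)" "open (p ` U)"
    using closedmap openmap opU by auto
  then have surj: "p ` U = UNIV"
    using connected_UNIV ne by (metis clopen image_is_empty)
  show ?thesis
  proof (rule covering_spaceI [OF contp surj])
    fix y :: 'b
    define F where "F = U \<inter> p -` {y}"
    have FU: "F \<subseteq> U" and Fy: "\<And>x. x \<in> F \<Longrightarrow> p x = y" by (auto simp: F_def)
    have "compact F"
      using proper [of "{y}"] by (simp add: F_def)
    obtain A where "\<forall>x\<in>U. open (A x) \<and> A x \<subseteq> U \<and> x \<in> A x \<and>
        (\<exists>V q. open V \<and> homeomorphism (A x) V p q)"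
      using bchoice [OF ballI [OF local]] by (rule exE)
    then have A: "\<And>x. x \<in> U \<Longrightarrow> open (A x)" "\<And>x. x \<in> U \<Longrightarrow> A x \<subseteq> U" "\<And>x. x \<in> U \<Longrightarrow> x \<in> A x"
      "\<And>x. x \<in> U \<Longrightarrow> \<exists>V q. open V \<and> homeomorphism (A x) V p q"
      by (simp_all del: ex_simps)
    \<comment> \<open>Injectivity of \<open>p\<close> on \<open>A x\<close> isolates
      \<open>x\<close> in its fibre; compactness then gives finiteness.\<close>
    have single: "A x \<inter> F = {x}" if "x \<in> F" for x
    proof -
      have "x \<in> U" using that FU by blast
      then obtain V q where "homeomorphism (A x) V p q" using A(4) by blast
      then have "inj_on p (A x)"
        by (meson homeomorphism_apply1 inj_on_inverseI)
      then have "z = x" if "z \<in> A x" "z \<in> F" for z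
        using inj_onD [of p "A x" z x] A(3) [OF \<open>x \<in> U\<close>] Fy that \<open>x \<in> F\<close> by simp
      then show ?thesis
        using that A(3) [OF \<open>x \<in> U\<close>] by blast
    qed
    have "finite F"
    proof -
      obtain D where D: "D \<subseteq> A ` F" "finite D" "F \<subseteq> \<Union>D"
      proof (rule compactE [OF \<open>compact F\<close>])
        show "F \<subseteq> \<Union>(A ` F)" using A(3) FU by blast
        show "open B" if "B \<in> A ` F" for B using that A(1) FU by blast
      qed
      have "F \<subseteq> (\<Union>B\<in>D. B \<inter> F)" using D by auto
      moreover have "finite (B \<inter> F)" if "B \<in> D" for B
        proof -
        obtain x where "x \<in> F" "B = A x" using D(1) \<open>B \<in> D\<close> by blast
        then show ?thesis using single by simp
      qed
      ultimately show ?thesis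
        using D(2) by (meson finite_UN finite_subset)
    qed
    \<comment> \<open>\<open>d x\<close> is at most the distance from \<open>x\<close> to any other
      fibre point, so the balls of half these radii are disjoint even when the radii differ.\<close>
    then obtain d where d: "\<And>x. d x > 0" "\<And>x x'. \<lbrakk>x' \<in> F; x' \<noteq> x\<rbrakk> \<Longrightarrow> d x \<le> dist x x'"
      using finite_set_avoid by metis
    define B where "B x = A x \<inter> ball x (d x / 2)" for x
    have B: "open (B x)" "x \<in> B x" "B x \<subseteq> A x" "B x \<subseteq> U" if "x \<in> F" for x
      using that FU A d by (auto simp: B_def)
    have disj: "B x \<inter> B x' = {}" if "x \<in> F" "x' \<in> F" "x \<noteq> x'" for x x'
    proof (rule ccontr)
      assume "B x \<inter> B x' \<noteq> {}"
      then obtain z where "dist x z < d x / 2" "dist x' z < d x' / 2" by (auto simp: B_def)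
      then have "dist x x' < (d x + d x') / 2"
        using dist_triangle [of x x' z] by (simp add: dist_commute)
      then show False
        using d(2) [of x' x] d(2) [of x x'] that by (simp add: dist_commute)
    qed
    \<comment> \<open>Removing the image of the rest of \<open>U\<close> forces every preimage of a
      point of \<open>W\<close> into some \<open>B x\<close>. The removed set is closed because
      \<open>p\<close> is a closed map.\<close>
    define W where "W = (\<Inter>x\<in>F. p ` B x) - p ` (U - (\<Union>x\<in>F. B x))"
    have "open W"
    proof -
      have "closed (p ` (U - (\<Union>x\<in>F. B x)))"
      proof (intro closedmap closedin_diff)
        show "openin (top_of_set U) (\<Union>x\<in>F. B x)"
          using B(1,4) opU by (auto simp: openin_open_eq)
      qed simp
      moreover have "open (\<Inter>x\<in>F. p ` B x)"
        using \<open>finite F\<close> B openmap by (intro open_INT) auto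
      ultimately show ?thesis by (simp add: W_def open_Diff)
    qed
    have "y \<in> W"
      using B Fy by (force simp: W_def F_def)
    have cover: "(\<Union>x\<in>F. B x \<inter> p -` W) = U \<inter> p -` W"
    proof (intro equalityI subsetI)
      show "x \<in> U \<inter> p -` W" if "x \<in> (\<Union>x\<in>F. B x \<inter> p -` W)" for x
        using that B(4) by blast
      show "x \<in> (\<Union>x\<in>F. B x \<inter> p -` W)" if "x \<in> U \<inter> p -` W" for x
        using that by (auto simp: W_def)
    qed
    show "\<exists>T. y \<in> T \<and> openin (top_of_set UNIV) T \<and>
        (\<exists>v. \<Union>v = U \<inter> p -` T \<and> (\<forall>u\<in>v. openin (top_of_set U) u) \<and>
          pairwise disjnt v \<and> (\<forall>u\<in>v. \<exists>q. homeomorphism u T p q))"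
    proof (intro exI [of _ W] exI [of _ "(\<lambda>x. B x \<inter> p -` W) ` F"] conjI ballI)
      show "openin (top_of_set U) u" if u: "u \<in> (\<lambda>x. B x \<inter> p -` W) ` F" for u
      proof -
        obtain x where x: "x \<in> F" "u = B x \<inter> p -` W"
          using u by (elim imageE)
        have "continuous_on (B x) p"
          using B(4) [OF x(1)] contp continuous_on_subset by blast
        then have "open u"
          using x B(1) [OF x(1)] \<open>open W\<close> by (simp add: continuous_open_preimage)
        moreover have "u \<subseteq> U"
          using x(2) B(4) [OF x(1)] by blast
        ultimately show ?thesis
          using opU by (simp add: openin_open_eq)
      qed
      show "pairwise disjnt ((\<lambda>x. B x \<inter> p -` W) ` F)"
      proof (rule pairwiseI, elim imageE)
        fix u u' x x'
        assume "u \<noteq> u'" "u = B x \<inter> p -` W" "x \<in> F" "u' = B x' \<inter> p -` W" "x' \<in> F"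
        moreover from this have "B x \<inter> B x' = {}"
          by (intro disj) auto
        ultimately show "disjnt u u'"
          by (auto simp: disjnt_def)
      qed
      show "\<exists>q. homeomorphism u W p q" if u: "u \<in> (\<lambda>x. B x \<inter> p -` W) ` F" for u
      proof -
        obtain x where x: "x \<in> F" "u = B x \<inter> p -` W"
          using u by (elim imageE)
        have "W \<subseteq> p ` B x" using x(1) unfolding W_def by blast
        then have "p ` u = W" using x(2) by blast
        moreover obtain V q where "homeomorphism (A x) V p q"
          using A(4) x(1) FU by blast
        moreover have "u \<subseteq> A x"
          using x B(3) by blast
        ultimately show ?thesis
          by (meson homeomorphism_of_subsets order_refl)
      qed
    qed (use \<open>y \<in> W\<close> \<open>open W\<close> cover in auto)
  qed
qed

text \<open>Simple connectedness lifts the identity of \<open>S\<close> to a section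
  \<open>s\<close> of \<open>p\<close>; connectedness of \<open>U\<close> makes this section a
  two-sided inverse.\<close>

lemma covering_space_of_simply_connected_homeomorphism:
  fixes p :: "'a::real_normed_vector \<Rightarrow> 'b::real_normed_vector"
  assumes cov: "covering_space U p S" and "connected U"
    and S: "simply_connected S" "locally path_connected S"
  obtains s where "homeomorphism U S p s"
proof -
  obtain s where s: "continuous_on S s" "s \<in> S \<rightarrow> U" "\<And>y. y \<in> S \<Longrightarrow> p (s y) = y"
    using covering_space_lift [OF cov S continuous_on_id] by (metis funcsetI)
  have pU: "continuous_on U p" "p ` U = S"
    using cov by (auto simp: covering_space_def)
  have "s (p x) = x" if "x \<in> U" for x
  proof -
    have "(s \<circ> p) x = id x"
    \<comment> \<open>Both maps are lifts of \<open>p\<close>. They agree at \<open>s (p x)\<close>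
      because \<open>s\<close> is a section, hence they agree on the connected set
      \<open>U\<close>.\<close>
    proof (rule covering_space_lift_unique [OF cov, where f = p and T = U and a = "s (p x)" and ?g1.0 = "s \<circ> p" and ?g2.0 = id])
      show "continuous_on U (s \<circ> p)"
        using pU s(1) by (intro continuous_on_compose) auto
    qed (use s pU that \<open>connected U\<close> in \<open>auto simp: continuous_on_id id_def\<close>)
    then show ?thesis by simp
  qed
  then have "homeomorphism U S p s"
    using s pU by (intro homeomorphismI) auto
  then show thesis ..
qed

text \<open>Hadamard's theorem: the inverse function theorem makes \<open>p\<close> a local
  homeomorphism, properness makes it a covering of the whole space, and a connected covering of a
  simply connected space has one sheet.\<close>

lemma proper_regular_imp_homeomorphism:
  fixes p :: "'a::euclidean_space \<Rightarrow> 'a"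
  assumes "open U" "connected U" "U \<noteq> {}"
    and der: "\<And>u. u \<in> U \<Longrightarrow> (p has_derivative blinfun_apply (D u)) (at u)"
    and contD: "continuous_on U D"
    and surj: "\<And>u. u \<in> U \<Longrightarrow> surj (blinfun_apply (D u))"
    and proper: "\<And>K. compact K \<Longrightarrow> compact (U \<inter> p -` K)"
  obtains s where "homeomorphism U UNIV p s"
proof -
  have "continuous_on U p"
    using der by (meson continuous_at_imp_continuous_on has_derivative_continuous)
  moreover have "\<exists>A. open A \<and> A \<subseteq> U \<and> x \<in> A \<and> (\<exists>V q. open V \<and> homeomorphism A V p q)" if x: "x \<in> U" for x
  proof -
    \<comment> \<open>Domain and target have the same dimension, so a surjective differential is
      invertible; \<open>L\<close> is the inverse that the inverse function theorem asks
      for.\<close>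
    obtain L where L: "linear L" "L \<circ> blinfun_apply (D x) = id"
      using linear_surjective_isomorphism [OF _ surj [OF x]] bounded_linear.linear [OF blinfun.bounded_linear_right]
        by (metis (no_types, lifting) eq_id_iff comp_apply)
    then have "Blinfun L o\<^sub>L D x = id_blinfun"
      by (intro blinfun_eqI) (simp add: bounded_linear_Blinfun_apply linear_conv_bounded_linear pointfree_idE)
    from inverse_function_theorem [OF \<open>open U\<close> der contD x this] show ?thesis
      by metis
  qed
  ultimately have "covering_space U p UNIV"
    using assms by (intro proper_local_homeomorphism_imp_covering_space) auto
  then obtain s where "homeomorphism U UNIV p s"
    using covering_space_of_simply_connected_homeomorphism [OF _ \<open>connected U\<close>]
      convex_imp_simply_connected convex_imp_locally_path_connected convex_UNIV by blast
  then show thesis by (rule that)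
qed

section \<open>Cells as connected open subsets of coordinate spaces\<close>

section \<open>Cells\<close>

text \<open>The coordinate subspace stays inside \<open>nat \<Rightarrow> real\<close>, so that
  cells of all lengths and dimensions live in one type during the induction on cells.\<close>

definition coord_space :: "nat set \<Rightarrow> (nat \<Rightarrow> real) set" where
  "coord_space S = {x. \<forall>j. j \<notin> S \<longrightarrow> x j = 0}"

definition coord_proj :: "nat set \<Rightarrow> (nat \<Rightarrow> real) \<Rightarrow> nat \<Rightarrow> real" where
  "coord_proj S x = (\<lambda>j. if j \<in> S then x j else 0)"

lemma coord_proj_upd:
  "coord_proj (insert n S) (x(n := t)) = (coord_proj S x)(n := t)"
  "n \<notin> S \<Longrightarrow> coord_proj S (x(n := t)) = coord_proj S x"
  by (auto simp: coord_proj_def fun_eq_iff)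

lemma continuous_on_coord_proj: "continuous_on A (coord_proj S)"
proof (rule continuous_on_coordinatewise_then_product)
  show "continuous_on A (\<lambda>x. coord_proj S x j)" for j
    by (cases "j \<in> S") (auto simp: coord_proj_def intro: continuous_on_subset [OF continuous_on_product_coordinates])
qed

lemma free_coords_snoc:
  "free_coords (\<sigma> @ [b]) = (if b then insert (length \<sigma>) (free_coords \<sigma>) else free_coords \<sigma>)"
  by (auto simp: free_coords_def nth_append less_Suc_eq)

lemma continuous_on_fun_upd [continuous_intros]:
  fixes F :: "'a::topological_space \<Rightarrow> 'b \<Rightarrow> 'c::topological_space"
  assumes "continuous_on S F" "continuous_on S h"
  shows "continuous_on S (\<lambda>y. (F y)(n := h y))"
proof (rule continuous_on_coordinatewise_then_product)
  show "continuous_on S (\<lambda>y. ((F y)(n := h y)) i)" for i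
    using assms by (cases "i = n") (auto intro: continuous_on_product_then_coordinatewise)
qed

text \<open>Parametrizing all fibres by one interval, continuously in the base point, exhibits the
  band as a continuous image of a product of connected sets.\<close>

lemma connected_band:
  fixes X :: "(nat \<Rightarrow> real) set"
  assumes "connected X"
    and lo: "\<And>\<alpha>. lo = Some \<alpha> \<Longrightarrow> continuous_on X \<alpha>"
    and up: "\<And>\<beta>. up = Some \<beta> \<Longrightarrow> continuous_on X \<beta>"
    and less: "\<And>\<alpha> \<beta> x. \<lbrakk>lo = Some \<alpha>; up = Some \<beta>; x \<in> X\<rbrakk> \<Longrightarrow> \<alpha> x < \<beta> x"
  shows "connected {x(n := t) | x t. x \<in> X \<and> (\<forall>\<alpha>. lo = Some \<alpha> \<longrightarrow> \<alpha> x < t) \<and> (\<forall>\<beta>. up = Some \<beta> \<longrightarrow> t < \<beta> x)}"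
    (is "connected ?M")
    and "X \<noteq> {} \<Longrightarrow> {x(n := t) | x t. x \<in> X \<and> (\<forall>\<alpha>. lo = Some \<alpha> \<longrightarrow> \<alpha> x < t) \<and> (\<forall>\<beta>. up = Some \<beta> \<longrightarrow> t < \<beta> x)} \<noteq> {}"
proof -
  define fib where "fib x = {t. (\<forall>\<alpha>. lo = Some \<alpha> \<longrightarrow> \<alpha> x < t) \<and> (\<forall>\<beta>. up = Some \<beta> \<longrightarrow> t < \<beta> x)}" for x
  \<comment> \<open>\<open>P\<close> is the line, the positive half-line or the open unit interval,
    according to which bounds are infinite; with two finite bounds, \<phi> interpolates linearly
    between them.\<close>
  have "\<exists>P \<phi>. connected P \<and> P \<noteq> {} \<and> continuous_on (X \<times> P) \<phi> \<and>
      (\<forall>x\<in>X. fib x = (\<lambda>u::real. \<phi> (x, u)) ` P)"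
  proof -
    have cont: "continuous_on (X \<times> P) (\<lambda>z. \<alpha> (fst z))" if "continuous_on X \<alpha>" for \<alpha> :: "(nat \<Rightarrow> real) \<Rightarrow> real" and P :: "real set"
      by (rule continuous_on_compose2 [OF that]) (auto intro: continuous_intros)
    consider "lo = None" "up = None" | \<alpha> where "lo = Some \<alpha>" "up = None"
      | \<beta> where "lo = None" "up = Some \<beta>" | \<alpha> \<beta> where "lo = Some \<alpha>" "up = Some \<beta>"
      by (cases lo; cases up) auto
    then show ?thesis
    proof cases
      case 1
      then show ?thesis
        by (intro exI [of _ UNIV] exI [of _ snd]) (auto simp: fib_def intro: continuous_intros)
    next
      case 2
      have "continuous_on (X \<times> {0<..}) (\<lambda>z. \<alpha> (fst z) + snd z)"
        by (intro continuous_intros cont lo 2)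
      moreover have "{t. \<alpha> x < t} = (\<lambda>u. \<alpha> x + u) ` {0<..}" for x
        by (auto intro!: image_eqI [of _ _ "_ - \<alpha> x"])
      ultimately show ?thesis
        using 2 by (intro exI [of _ "{0<..}"] exI [of _ "\<lambda>z. \<alpha> (fst z) + snd z"]) (auto simp: fib_def)
    next
      case 3
      have "continuous_on (X \<times> {0<..}) (\<lambda>z. \<beta> (fst z) - snd z)"
        by (intro continuous_intros cont up 3)
      moreover have "{t. t < \<beta> x} = (\<lambda>u. \<beta> x - u) ` {0<..}" for x
        by (auto intro!: image_eqI [of _ _ "\<beta> x - _"])
      ultimately show ?thesis
        using 3 by (intro exI [of _ "{0<..}"] exI [of _ "\<lambda>z. \<beta> (fst z) - snd z"]) (auto simp: fib_def)
    next
      case 4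
      let ?\<phi> = "\<lambda>z. \<alpha> (fst z) + (\<beta> (fst z) - \<alpha> (fst z)) * snd z"
      have "continuous_on (X \<times> {0<..<1}) ?\<phi>"
        by (intro continuous_intros cont lo up 4)
      moreover have "{t. \<alpha> x < t \<and> t < \<beta> x} = (\<lambda>u. \<alpha> x + (\<beta> x - \<alpha> x) * u) ` {0<..<1}" (is "?A = ?B")
        if "x \<in> X" for x
      proof (intro equalityI subsetI)
        fix t assume "t \<in> ?A"
        then show "t \<in> ?B"
          by (intro image_eqI [of _ _ "(t - \<alpha> x) / (\<beta> x - \<alpha> x)"]) auto
      next
        fix t assume "t \<in> ?B"
        then obtain u where u: "0 < u" "u < 1" "t = \<alpha> x + (\<beta> x - \<alpha> x) * u" by auto
        have "0 < \<beta> x - \<alpha> x" using less [OF 4 that] by simp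
        then have "0 < (\<beta> x - \<alpha> x) * u" "(\<beta> x - \<alpha> x) * u < (\<beta> x - \<alpha> x) * 1"
          using u by (auto intro: mult_strict_left_mono simp del: mult_1_right)
        then show "t \<in> ?A" using u by auto
      qed
      ultimately show ?thesis
        using 4 by (intro exI [of _ "{0<..<1}"] exI [of _ ?\<phi>]) (auto simp: fib_def)
    qed
  qed
  then obtain P \<phi> where "connected P \<and> P \<noteq> {} \<and> continuous_on (X \<times> P) \<phi> \<and>
      (\<forall>x\<in>X. fib x = (\<lambda>u::real. \<phi> (x, u)) ` P)"
    by (elim exE)
  then have P: "connected P" "P \<noteq> {}" "continuous_on (X \<times> P) \<phi>"
    and fib: "\<And>x. x \<in> X \<Longrightarrow> fib x = (\<lambda>u. \<phi> (x, u)) ` P"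
    by blast+
  have M: "?M = (\<lambda>z. (fst z)(n := \<phi> z)) ` (X \<times> P)"
  proof -
    have "?M = (\<Union>x\<in>X. (\<lambda>t. x(n := t)) ` fib x)"
      unfolding fib_def by blast
    also have "\<dots> = (\<Union>x\<in>X. (\<lambda>t. x(n := t)) ` (\<lambda>u. \<phi> (x, u)) ` P)"
      using fib by simp
    also have "\<dots> = (\<lambda>z. (fst z)(n := \<phi> z)) ` (X \<times> P)"
      by force
    finally show ?thesis .
  qed
  have "continuous_on (X \<times> P) (\<lambda>z. (fst z)(n := \<phi> z))"
    by (intro continuous_intros P)
  then show "connected ?M"
    unfolding M using assms(1) P(1) by (intro connected_continuous_image connected_Times)
  show "?M \<noteq> {}" if "X \<noteq> {}"
    using that P(2) unfolding M by simp
qed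

text \<open>Induction on the cell. A graph changes neither the free coordinates nor the projected
  image. A band gains one free coordinate, and its image is cut out of an open cylinder by strict
  inequalities between continuous functions.\<close>

lemma cell_homeomorphic_open_cell:
  assumes "is_cell R \<sigma> M"
  shows "M \<subseteq> Rn (length \<sigma>) \<and> M \<noteq> {} \<and> connected M \<and>
    openin (top_of_set (coord_space (free_coords \<sigma>))) (coord_proj (free_coords \<sigma>) ` M) \<and>
    (\<exists>s. homeomorphism M (coord_proj (free_coords \<sigma>) ` M) (coord_proj (free_coords \<sigma>)) s)"
  using assms
proof induction
  case point
  have F: "free_coords [] = {}" by (auto simp: free_coords_def)
  have eq: "Rn 0 = {\<lambda>_. 0}" "coord_space {} = {\<lambda>_. 0}" "coord_proj {} = (\<lambda>_ _. 0)"
    by (auto simp: Rn_def coord_space_def coord_proj_def fun_eq_iff)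
  have "homeomorphism {\<lambda>_. 0} {\<lambda>_. 0} (\<lambda>_ _. 0) (\<lambda>_ _. 0 :: real)"
    by (auto simp: homeomorphism_def)
  then show ?case
    by (auto simp: F eq)
next
  case (graph \<sigma> X \<alpha>)
  let ?F = "free_coords \<sigma>" and ?n = "length \<sigma>"
  let ?M = "{x(?n := \<alpha> x) | x. x \<in> X}"
  obtain s where s: "homeomorphism X (coord_proj ?F ` X) (coord_proj ?F) s"
    using graph.IH by blast
  have n: "?n \<notin> ?F" by (simp add: free_coords_def)
  have M: "?M = (\<lambda>x. x(?n := \<alpha> x)) ` X" by blast
  have pM: "coord_proj ?F ` ?M = coord_proj ?F ` X"
    unfolding M image_image using n by (simp add: coord_proj_upd)
  have contu: "continuous_on X (\<lambda>x. x(?n := \<alpha> x))"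
    using graph by (intro continuous_intros)
  \<comment> \<open>The inverse recovers the base point by \<open>s\<close> and then restores the
    dependent coordinate by evaluating \<alpha> there.\<close>
  have "homeomorphism ?M (coord_proj ?F ` X) (coord_proj ?F) (\<lambda>y. (s y)(?n := \<alpha> (s y)))"
  proof (intro homeomorphismI)
    show "continuous_on ?M (coord_proj ?F)"
      by (rule continuous_on_coord_proj)
    show "continuous_on (coord_proj ?F ` X) (\<lambda>y. (s y)(?n := \<alpha> (s y)))"
      using continuous_on_compose2 [OF contu, of "coord_proj ?F ` X" s] s by (auto simp: homeomorphism_def)
    show "coord_proj ?F ` ?M \<subseteq> coord_proj ?F ` X" using pM by simp
    show "(\<lambda>y. (s y)(?n := \<alpha> (s y))) ` coord_proj ?F ` X \<subseteq> ?M"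
      using s by (auto simp: homeomorphism_def)
    show "(s (coord_proj ?F x))(?n := \<alpha> (s (coord_proj ?F x))) = x" if "x \<in> ?M" for x
      using that s n by (auto simp: homeomorphism_def coord_proj_upd)
    show "coord_proj ?F ((s y)(?n := \<alpha> (s y))) = y" if "y \<in> coord_proj ?F ` X" for y
      using that s n by (auto simp: homeomorphism_def coord_proj_upd)
  qed
  moreover have "connected ?M"
    unfolding M using graph.IH contu by (intro connected_continuous_image) auto
  moreover have "?M \<subseteq> Rn (Suc ?n)"
    using graph.IH by (auto simp: Rn_def)
  ultimately show ?case
    using graph.IH by (auto simp: free_coords_snoc pM simp del: fun_upd_apply)
next
  case (band \<sigma> X lo up)
  let ?F = "free_coords \<sigma>" and ?n = "length \<sigma>"
  let ?F' = "insert ?n ?F"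
  let ?fib = "\<lambda>x t. (\<forall>\<alpha>. lo = Some \<alpha> \<longrightarrow> \<alpha> x < t) \<and> (\<forall>\<beta>. up = Some \<beta> \<longrightarrow> t < \<beta> x)"
  let ?M = "{x(?n := t) | x t. x \<in> X \<and> ?fib x t}"
  let ?U = "coord_proj ?F ` X"
  obtain s where s: "homeomorphism X ?U (coord_proj ?F) s"
    using band.IH by blast
  have n: "?n \<notin> ?F" by (simp add: free_coords_def)
  have XRn: "x ?n = 0" if "x \<in> X" for x
    using band.IH that by (auto simp: Rn_def)
  have lo: "continuous_on X \<alpha>" if "lo = Some \<alpha>" for \<alpha>
    using band that by (auto simp: admissible_bound_def)
  have up: "continuous_on X \<beta>" if "up = Some \<beta>" for \<beta>
    using band that by (auto simp: admissible_bound_def)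
  have contn: "continuous_on S (\<lambda>y. y(?n := 0))" for S :: "(nat \<Rightarrow> real) set"
    by (intro continuous_intros)
  \<comment> \<open>The cylinder over \<open>?U\<close>: as \<open>?n\<close> is not in
    \<open>?F\<close>, resetting coordinate \<open>?n\<close> to \<open>0\<close> projects to the
    base. On \<open>T\<close>, applying \<open>s\<close> after this reset gives a base point in
    \<open>X\<close>, so the bounds become continuous functions on \<open>T\<close>.\<close>
  define T where "T = coord_space ?F' \<inter> (\<lambda>y. y(?n := 0)) -` ?U"
  have T: "openin (top_of_set (coord_space ?F')) T"
    unfolding T_def
    by (rule continuous_openin_preimage [of _ _ "coord_space ?F"])
      (use band.IH contn in \<open>auto simp: coord_space_def\<close>)
  have sT: "continuous_on T (\<lambda>y. s (y(?n := 0)))" "(\<lambda>y. s (y(?n := 0))) ` T \<subseteq> X"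
    using continuous_on_compose2 [OF _ contn, of ?U s T] s by (auto simp: homeomorphism_def T_def)
  have contT: "continuous_on T (\<lambda>y. \<alpha> (s (y(?n := 0))) - y ?n)" if "continuous_on X \<alpha>" for \<alpha>
    using continuous_on_compose2 [OF that sT]
    by (intro continuous_intros continuous_on_subset [OF continuous_on_product_coordinates]) auto
  have pM: "coord_proj ?F' ` ?M = {y \<in> T. ?fib (s (y(?n := 0))) (y ?n)}"
  proof (intro equalityI subsetI)
    fix y assume "y \<in> coord_proj ?F' ` ?M"
    then obtain x t where x: "x \<in> X" "?fib x t" "y = (coord_proj ?F x)(?n := t)"
      by (auto simp: coord_proj_upd)
    have "y(?n := 0) = coord_proj ?F x"
      using x n by (auto simp: coord_proj_def fun_eq_iff)
    moreover have "y \<in> coord_space ?F'"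
      using x by (auto simp: coord_proj_def coord_space_def)
    ultimately show "y \<in> {y \<in> T. ?fib (s (y(?n := 0))) (y ?n)}"
      using x s by (auto simp: T_def homeomorphism_def)
  next
    fix y assume y: "y \<in> {y \<in> T. ?fib (s (y(?n := 0))) (y ?n)}"
    then obtain x where x: "x \<in> X" "y(?n := 0) = coord_proj ?F x" by (auto simp: T_def)
    then have "y = coord_proj ?F' (x(?n := y ?n))"
      by (metis coord_proj_upd(1) fun_upd_triv fun_upd_upd)
    moreover have "?fib x (y ?n)"
      using y x s by (auto simp: homeomorphism_def)
    ultimately show "y \<in> coord_proj ?F' ` ?M" using x by blast
  qed
  have "openin (top_of_set T) (coord_proj ?F' ` ?M)"
  proof -
    have "openin (top_of_set T) {y \<in> T. \<forall>\<alpha>. lo = Some \<alpha> \<longrightarrow> \<alpha> (s (y(?n := 0))) < y ?n}"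
    proof (cases lo)
      case (Some \<alpha>)
      have "openin (top_of_set T) (T \<inter> (\<lambda>y. \<alpha> (s (y(?n := 0))) - y ?n) -` {..<0})"
        by (rule continuous_openin_preimage_gen [OF contT [OF lo [OF Some]]]) simp
      also have "T \<inter> (\<lambda>y. \<alpha> (s (y(?n := 0))) - y ?n) -` {..<0} =
          {y \<in> T. \<forall>\<alpha>. lo = Some \<alpha> \<longrightarrow> \<alpha> (s (y(?n := 0))) < y ?n}"
        using Some by auto
      finally show ?thesis .
    qed auto
    moreover have "openin (top_of_set T) {y \<in> T. \<forall>\<beta>. up = Some \<beta> \<longrightarrow> y ?n < \<beta> (s (y(?n := 0)))}"
    proof (cases up)
      case (Some \<beta>)
      have "openin (top_of_set T) (T \<inter> (\<lambda>y. \<beta> (s (y(?n := 0))) - y ?n) -` {0<..})"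
        by (rule continuous_openin_preimage_gen [OF contT [OF up [OF Some]]]) simp
      also have "T \<inter> (\<lambda>y. \<beta> (s (y(?n := 0))) - y ?n) -` {0<..} =
          {y \<in> T. \<forall>\<beta>. up = Some \<beta> \<longrightarrow> y ?n < \<beta> (s (y(?n := 0)))}"
        using Some by auto
      finally show ?thesis .
    qed auto
    ultimately have "openin (top_of_set T) ({y \<in> T. \<forall>\<alpha>. lo = Some \<alpha> \<longrightarrow> \<alpha> (s (y(?n := 0))) < y ?n} \<inter>
        {y \<in> T. \<forall>\<beta>. up = Some \<beta> \<longrightarrow> y ?n < \<beta> (s (y(?n := 0)))})"
      by (rule openin_Int)
    also have "\<dots> = coord_proj ?F' ` ?M"
      unfolding pM by blast
    finally show ?thesis .
  qed
  then have "openin (top_of_set (coord_space ?F')) (coord_proj ?F' ` ?M)"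
    using T openin_trans by blast
  moreover have "homeomorphism ?M (coord_proj ?F' ` ?M) (coord_proj ?F') (\<lambda>y. (s (y(?n := 0)))(?n := y ?n))"
  proof (intro homeomorphismI)
    show "continuous_on ?M (coord_proj ?F')"
      by (rule continuous_on_coord_proj)
    have "continuous_on T (\<lambda>y. (s (y(?n := 0)))(?n := y ?n))"
      by (intro continuous_intros sT continuous_on_subset [OF continuous_on_product_coordinates]) auto
    then show "continuous_on (coord_proj ?F' ` ?M) (\<lambda>y. (s (y(?n := 0)))(?n := y ?n))"
      by (rule continuous_on_subset) (use pM in auto)
    have inv: "(s ((coord_proj ?F' x)(?n := 0)))(?n := coord_proj ?F' x ?n) = x" if x: "x \<in> ?M" for x
    proof -
      obtain z t where z: "z \<in> X" "x = z(?n := t)" using x by blast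
      have "(coord_proj ?F' x)(?n := 0) = coord_proj ?F z"
        using z n XRn by (auto simp: coord_proj_def fun_eq_iff)
      then show ?thesis
        using z s by (auto simp: homeomorphism_def coord_proj_def)
    qed
    then show "(s ((coord_proj ?F' x)(?n := 0)))(?n := coord_proj ?F' x ?n) = x" if "x \<in> ?M" for x
      using that .
    show "(\<lambda>y. (s (y(?n := 0)))(?n := y ?n)) ` coord_proj ?F' ` ?M \<subseteq> ?M"
    proof (rule image_subsetI, erule imageE)
      fix x y assume "y = coord_proj ?F' x" "x \<in> ?M"
      then show "(s (y(?n := 0)))(?n := y ?n) \<in> ?M"
        by (simp only: inv)
    qed
    show "coord_proj ?F' ((s (y(?n := 0)))(?n := y ?n)) = y" if "y \<in> coord_proj ?F' ` ?M" for y
      using that by (elim imageE) (simp only: inv)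
  qed auto
  moreover have "connected ?M" "?M \<noteq> {}"
    using connected_band [of X lo up ?n] band lo up by auto
  moreover have "?M \<subseteq> Rn (Suc ?n)"
    using band.IH by (auto simp: Rn_def)
  ultimately show ?case
    by (auto simp: free_coords_snoc simp del: fun_upd_apply)
qed

text \<open>The labelling \<open>e\<close> identifies the coordinate subspace with
  \<open>real ^ 'k\<close>, which transfers the properties of \<open>coord_proj\<close> to
  \<open>chart\<close>.\<close>

lemma k_cell_chart_homeomorphism:
  fixes e :: "'k::finite \<Rightarrow> nat"
  assumes "k_cell R n e M"
  shows "open (chart e ` M)" "connected (chart e ` M)" "M \<noteq> {}"
    "\<exists>s. homeomorphism M (chart e ` M) (chart e) s"
proof -
  obtain \<sigma> where \<sigma>: "is_cell R \<sigma> M" "bij_betw e UNIV (free_coords \<sigma>)"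
    using assms by (auto simp: k_cell_def)
  define F where "F = free_coords \<sigma>"
  have e: "inj e" "range e = F"
    using \<sigma>(2) by (auto simp: F_def bij_betw_def)
  obtain s where "connected M" and ne: "M \<noteq> {}"
    and op: "openin (top_of_set (coord_space F)) (coord_proj F ` M)"
    and s: "homeomorphism M (coord_proj F ` M) (coord_proj F) s"
    using cell_homeomorphic_open_cell [OF \<sigma>(1)] unfolding F_def by blast
  \<comment> \<open>The inverse relabelling, filled up with \<open>0\<close> outside
    \<open>F\<close>. Following it by \<open>chart e\<close> gives the identity; applying it after
    \<open>chart e\<close> gives \<open>coord_proj F\<close>.\<close>
  define \<psi> where "\<psi> u j = (if j \<in> F then u $ inv e j else 0)" for u :: "real ^ 'k" and j
  have cont\<psi>: "continuous_on A \<psi>" for A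
  proof (rule continuous_on_coordinatewise_then_product)
    show "continuous_on A (\<lambda>u. \<psi> u j)" for j
      by (cases "j \<in> F") (auto simp: \<psi>_def intro: continuous_intros)
  qed
  have contc: "continuous_on A (chart e)" for A
    unfolding chart_def
    by (intro continuous_on_vec_lambda continuous_on_subset [OF continuous_on_product_coordinates]) auto
  have \<psi>c: "\<psi> (chart e x) = coord_proj F x" for x
    using e by (auto simp: \<psi>_def chart_def coord_proj_def fun_eq_iff)
  have c\<psi>: "chart e (\<psi> u) = u" for u
    using e by (auto simp: \<psi>_def chart_def vec_eq_iff)
  have cp: "chart e (coord_proj F x) = chart e x" for x
    using e by (auto simp: coord_proj_def chart_def vec_eq_iff)
  \<comment> \<open>Relative openness in the coordinate subspace turns into openness in
    \<open>real ^ 'k\<close>, since \<psi> is continuous with all values in that subspace.\<close>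
  have U: "chart e ` M = \<psi> -` (coord_proj F ` M)"
  proof (intro equalityI subsetI)
    show "u \<in> \<psi> -` (coord_proj F ` M)" if "u \<in> chart e ` M" for u
      using that \<psi>c by auto
    fix u assume "u \<in> \<psi> -` (coord_proj F ` M)"
    then obtain x where "x \<in> M" "\<psi> u = coord_proj F x" by auto
    then show "u \<in> chart e ` M" using c\<psi> cp by (metis imageI)
  qed
  obtain T where T: "open T" "coord_proj F ` M = coord_space F \<inter> T"
    using op by (auto simp: openin_open)
  have "\<psi> u \<in> coord_space F" for u
    by (simp add: \<psi>_def coord_space_def)
  then have "chart e ` M = \<psi> -` T"
    unfolding U T(2) by auto
  then show "open (chart e ` M)"
    using T(1) cont\<psi> open_vimage by metis
  show "connected (chart e ` M)"
    using contc \<open>connected M\<close> by (rule connected_continuous_image)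
  show "M \<noteq> {}" by (rule ne)
  have "homeomorphism M (chart e ` M) (chart e) (\<lambda>u. s (\<psi> u))"
  proof (rule homeomorphismI)
    have "continuous_on (coord_proj F ` M) s"
      using s by (simp add: homeomorphism_def)
    then show "continuous_on (chart e ` M) (\<lambda>u. s (\<psi> u))"
      by (rule continuous_on_compose2 [OF _ cont\<psi>]) (use U in auto)
  qed (use s contc in \<open>auto simp: \<psi>c homeomorphism_def\<close>)
  then show "\<exists>s. homeomorphism M (chart e ` M) (chart e) s" by blast
qed

text \<open>The global inversion result is applied to \<open>H\<close> read in the chart, and the
  homeomorphism is pulled back to \<open>M\<close> along the chart.\<close>

lemma proper_regular_on_cell_imp_homeomorphism:
  fixes e :: "'k::finite \<Rightarrow> nat" and H :: "(nat \<Rightarrow> real) \<Rightarrow> real ^ 'k"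
  assumes cell: "k_cell R n e M" and reg: "regular_on_cell e M H" and proper: "proper_on M H"
  obtains s where "homeomorphism M UNIV H s"
proof -
  let ?U = "chart e ` M" and ?p = "in_chart e M H"
  obtain t where t: "homeomorphism M ?U (chart e) t"
    using k_cell_chart_homeomorphism(4) [OF cell] ..
  then have "inj_on (chart e) M"
    by (metis homeomorphism_apply1 inj_on_inverseI)
  then have p: "?p (chart e x) = H x" if "x \<in> M" for x
    using that by (simp add: in_chart_def)
  obtain D where der: "\<And>u. u \<in> ?U \<Longrightarrow> (?p has_derivative blinfun_apply (D u)) (at u)"
    and contD: "continuous_on ?U D"
    using reg unfolding regular_on_cell_def C1_on_cell_def by blast
  obtain s where "homeomorphism ?U UNIV ?p s"
  proof (rule proper_regular_imp_homeomorphism [OF k_cell_chart_homeomorphism(1,2) [OF cell] _ der contD])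
    show "?U \<noteq> {}" using k_cell_chart_homeomorphism(3) [OF cell] by simp
    show "surj (blinfun_apply (D u))" if "u \<in> ?U" for u
      using reg that frechet_derivative_at [OF der [OF that]] unfolding regular_on_cell_def by metis
    show "compact (?U \<inter> ?p -` K)" if "compact K" for K
    proof -
      \<comment> \<open>Preimages under the map in the chart are chart images of preimages in
        \<open>M\<close>, so properness carries over.\<close>
      have "?U \<inter> ?p -` K = chart e ` {x \<in> M. H x \<in> K}"
        using p by auto
      moreover have "continuous_on {x \<in> M. H x \<in> K} (chart e)"
        using t by (auto simp: homeomorphism_def intro: continuous_on_subset)
      ultimately show ?thesis
        using proper that by (simp add: proper_on_def compact_continuous_image)
    qed
  qed
  from homeomorphism_compose [OF t this] have "homeomorphism M UNIV H (t \<circ> s)"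
    by (rule homeomorphism_cong) (use p in auto)
  then show thesis by (rule that)
qed

section \<open>Compactness by induction on the dimension of the slice\<close>

section \<open>Enclosed regions\<close>

text \<open>Pushing each nonzero vector outward by \<open>r\<close> maps the punctured subspace
  continuously onto this set, and the punctured subspace is connected from dimension two on.\<close>

lemma connected_subspace_outside_ball:
  fixes N :: "'a::euclidean_space set"
  assumes N: "subspace N" "dim N \<ge> 2" and "r \<ge> 0"
  shows "connected {y \<in> N. norm y > r}"
proof -
  have conn: "connected (N - {0})"
    using N by (intro connected_punctured_convex) (auto simp: subspace_imp_convex aff_dim_subspace)
  have cont: "continuous_on (N - {0}) (\<lambda>y. (1 + r / norm y) *\<^sub>R y)"
    by (intro continuous_intros) auto
  have "(\<lambda>y. (1 + r / norm y) *\<^sub>R y) ` (N - {0}) = {y \<in> N. norm y > r}" (is "?f ` _ = ?C")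
  proof (intro equalityI subsetI)
    fix y assume "y \<in> ?f ` (N - {0})"
    then obtain z where z: "z \<in> N" "z \<noteq> 0" "y = ?f z" by auto
    have "norm y = \<bar>1 + r / norm z\<bar> * norm z" using z by simp
    also have "\<dots> = norm z + r"
      using z \<open>r \<ge> 0\<close> by (simp add: abs_of_nonneg algebra_simps add_nonneg_nonneg)
    finally show "y \<in> ?C"
      using z N(1) by (simp add: subspace_scale)
  next
    fix y assume y: "y \<in> ?C"
    \<comment> \<open>The preimage of \<open>y\<close>: the vector moved inward by
      \<open>r\<close>.\<close>
    let ?z = "(1 - r / norm y) *\<^sub>R y"
    have y0: "norm y > 0" using y \<open>r \<ge> 0\<close> by auto
    then have c: "1 - r / norm y > 0" using y by (simp add: field_simps)
    have "norm ?z = \<bar>1 - r / norm y\<bar> * norm y" by simp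
    also have "\<dots> = norm y - r"
      using c y0 by (simp add: abs_of_pos algebra_simps)
    finally have nz: "norm ?z = norm y - r" .
    have "(1 + r / norm ?z) * (1 - r / norm y) = 1"
      unfolding nz using y y0 by (simp add: field_simps)
    then have yz: "y = ?f ?z" by (simp del: norm_scaleR)
    have "?z \<in> N - {0}"
      using y c y0 N(1) by (auto simp: subspace_scale)
    then show "y \<in> ?f ` (N - {0})" by (rule image_eqI [of y ?f ?z, OF yz])
  qed
  then show ?thesis
    using connected_continuous_image [OF cont conn] by (simp only:)
qed

lemma norm_axis: "norm (axis i c :: real ^ 'k) = \<bar>c\<bar>"
  by (simp add: norm_eq_sqrt_inner inner_axis_axis)

text \<open>The enclosed region after normalisation: the chosen signs are absorbed into
  \<open>h\<close>, so that every inequality reads \<open>\<ge> 0\<close>.\<close>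

definition region :: "'a set \<Rightarrow> ('k \<Rightarrow> bool \<Rightarrow> 'a \<Rightarrow> real) \<Rightarrow> 'k set \<Rightarrow> ('k \<Rightarrow> bool) \<Rightarrow> 'a set" where
  "region M h J \<tau> = {x \<in> M. (\<forall>i\<in>-J. \<forall>\<epsilon>. h i \<epsilon> x \<ge> 0) \<and> (\<forall>l\<in>J. h l (\<tau> l) x = 0)}"

text \<open>\<open>hom\<close> is the outcome of the covering argument and \<open>pos\<close>
  records the choice of signs. The induction ranges over all \<tau> because, when an index joins
  \<open>J\<close>, either function of its pair may be the vanishing one.\<close>

lemma compact_region:
  fixes M :: "'a::topological_space set" and h :: "'k::finite \<Rightarrow> bool \<Rightarrow> 'a \<Rightarrow> real"
  assumes hom: "\<And>\<tau>. \<exists>s. homeomorphism M (UNIV :: (real ^ 'k) set) (\<lambda>x. \<chi> i. h i (\<tau> i) x) s"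
    and pos: "\<And>i \<epsilon> x. \<lbrakk>x \<in> M; h i (\<not> \<epsilon>) x = 0\<rbrakk> \<Longrightarrow> h i \<epsilon> x > 0"
  shows "compact (region M h J \<tau>)"
proof (induction "card (- J)" arbitrary: J \<tau> rule: less_induct)
  case less
  define H where "H \<tau> x = (\<chi> i. h i (\<tau> i) x)" for \<tau> x
  have Hi: "H \<tau> x $ i = h i (\<tau> i) x" for \<tau> x i by (simp add: H_def)
  obtain S where "\<And>\<tau>. homeomorphism M UNIV (H \<tau>) (S \<tau>)"
    using hom unfolding H_def by metis
  then have S: "continuous_on UNIV (S \<tau>)" "S \<tau> y \<in> M" "H \<tau> (S \<tau> y) = y" "x \<in> M \<Longrightarrow> S \<tau> (H \<tau> x) = x"
    and contH: "continuous_on M (H \<tau>)" for \<tau> x y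
    by (auto simp: homeomorphism_def)
  have hS: "h i (\<tau> i) (S \<tau> y) = y $ i" for i \<tau> y
    using S(3) [of \<tau> y] Hi by metis
  have conth: "continuous_on M (h i \<epsilon>)" for i \<epsilon>
    using continuous_on_component [OF contH [of "\<lambda>_. \<epsilon>"], of i] by (simp add: Hi)
  have conthS: "continuous_on A (\<lambda>y. h i \<epsilon> (S \<tau> y))" for i \<epsilon> \<tau> A
    using S by (intro continuous_on_compose2 [OF conth] continuous_on_subset [OF S(1)]) auto
  \<comment> \<open>In the coordinates given by \<open>H \<tau>\<close>, the slice on which the
    equations for \<open>J\<close> hold is the subspace \<open>N\<close>, and the region becomes
    \<open>B\<close>.\<close>
  define N where "N = {y :: real ^ 'k. \<forall>l\<in>J. y $ l = 0}"
  define B where "B = {y \<in> N. \<forall>i\<in>-J. \<forall>\<epsilon>. h i \<epsilon> (S \<tau> y) \<ge> 0}"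
  have "subspace N"
    by (auto simp: N_def subspace_def)
  have reg: "region M h J \<tau> = S \<tau> ` B"
  proof (intro equalityI subsetI)
    fix x assume x: "x \<in> region M h J \<tau>"
    then have "S \<tau> (H \<tau> x) = x" using S by (auto simp: region_def)
    moreover from this x have "H \<tau> x \<in> B"
      by (auto simp: region_def B_def N_def Hi)
    ultimately show "x \<in> S \<tau> ` B" by (metis imageI)
  next
    fix x assume "x \<in> S \<tau> ` B"
    then show "x \<in> region M h J \<tau>"
      using S hS by (auto simp: region_def B_def N_def)
  qed
  have Bnonneg: "h i \<epsilon> (S \<tau> y) \<ge> 0" if "y \<in> B" "i \<in> - J" for i \<epsilon> y
    using that by (simp add: B_def)
  have "B = N \<inter> (\<Inter>i\<in>-J. \<Inter>\<epsilon>. {y. 0 \<le> h i \<epsilon> (S \<tau> y)})"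
    by (auto simp: B_def)
  moreover have "closed (\<Inter>i\<in>-J. \<Inter>\<epsilon>. {y. 0 \<le> h i \<epsilon> (S \<tau> y)})"
    by (intro closed_INT ballI closed_Collect_le conthS continuous_on_const)
  ultimately have "closed B"
    using \<open>subspace N\<close> by (simp add: closed_Int closed_subspace)
  moreover have "bounded B"
  proof -
    consider "card (- J) = 0" | "card (- J) = 1" | "card (- J) \<ge> 2" by linarith
    then show ?thesis
    proof cases
      case 1
      then have "- J = {}" by simp
      then have "J = UNIV" by blast
      then have "B \<subseteq> {0}" by (auto simp: B_def N_def vec_eq_iff)
      then show ?thesis by (rule bounded_subset [rotated]) simp
    next
      case 2
      then obtain i where i: "- J = {i}" by (rule card_1_singletonE)
      have iJ: "l \<in> J \<longleftrightarrow> l \<noteq> i" for l using i by auto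
      \<comment> \<open>Switching the choice at \<open>i\<close> keeps the other equations, so
        \<open>H \<tau>\<close> and \<open>H \<tau>'\<close> parametrize the same curve in
        \<open>M\<close>, with \<phi> as the change of parameter.\<close>
      define \<tau>' where "\<tau>' = \<tau>(i := \<not> \<tau> i)"
      define \<phi> where "\<phi> c = h i (\<not> \<tau> i) (S \<tau> (axis i c))" for c
      have H': "H \<tau>' (S \<tau> (axis i c)) = axis i (\<phi> c)" for c
        using hS [of _ \<tau> "axis i c"] by (auto simp: vec_eq_iff Hi \<tau>'_def \<phi>_def axis_def)
      have "inj \<phi>"
        by (rule injI) (metis H' S(2,3,4) axis_eq_axis)
      moreover have "continuous_on A \<phi>" for A
      proof -
        have "continuous_on A (\<lambda>c. if j = i then c else 0)" for j
          by (cases "j = i") auto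
        then have "continuous_on A (\<lambda>c. axis i c :: real ^ 'k)"
          unfolding axis_def by (rule continuous_on_vec_lambda)
        then show ?thesis
          unfolding \<phi>_def by (rule continuous_on_compose2 [OF conthS [of UNIV]]) simp
      qed
      moreover have "\<phi> 0 > 0"
        unfolding \<phi>_def using pos [of "S \<tau> (axis i 0)" i "\<not> \<tau> i"] S hS [of i \<tau> "axis i 0"] by simp
      moreover obtain c0 where c0: "c0 > 0" "\<phi> c0 = 0"
      proof
        \<comment> \<open>The common zero of the functions selected by \<open>\<tau>'\<close> lies
          on the curve. By \<open>pos\<close> its \<tau>-parameter is positive, and this parameter
          is the zero of \<phi>.\<close>
        let ?x = "S \<tau>' 0"
        have z: "h l (\<tau>' l) ?x = 0" for l using hS by simp
        show "h i (\<tau> i) ?x > 0"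
          using pos [of ?x i "\<tau> i"] z [of i] S by (simp add: \<tau>'_def)
        have "h l (\<tau> l) ?x = 0" if "l \<noteq> i" for l
          using z [of l] that by (simp add: \<tau>'_def)
        then have "H \<tau> ?x = axis i (h i (\<tau> i) ?x)"
          by (auto simp: vec_eq_iff Hi axis_def)
        then have "S \<tau> (axis i (h i (\<tau> i) ?x)) = ?x"
          using S by metis
        then show "\<phi> (h i (\<tau> i) ?x) = 0"
          using z [of i] by (simp add: \<phi>_def \<tau>'_def)
      qed
      \<comment> \<open>A continuous injective function is strictly monotone; since \<phi> falls
        from a positive value at \<open>0\<close> to zero at \<open>c0\<close>, it is negative
        beyond.\<close>
      ultimately have neg: "\<phi> c < 0" if "c > c0" for c
        using continuous_inj_imp_mono [of 0 c0 c \<phi>] that by (metis inj_on_subset not_less_iff_gr_or_eq subset_UNIV)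
      have "norm y \<le> c0" if "y \<in> B" for y
      proof -
        have y: "y = axis i (y $ i)"
          using that iJ by (auto simp: vec_eq_iff axis_def B_def N_def)
        have "y $ i \<ge> 0"
          using Bnonneg [OF that, of i "\<tau> i"] i hS [of i \<tau> y] by simp
        moreover have "\<phi> (y $ i) \<ge> 0"
          unfolding \<phi>_def y [symmetric] using Bnonneg [OF that] i by simp
        ultimately have "\<bar>y $ i\<bar> \<le> c0" using neg [of "y $ i"] by linarith
        then show ?thesis
          using y by (metis norm_axis real_norm_def)
      qed
      then show ?thesis by (auto simp: bounded_iff)
    next
      case 3
      then obtain i i' where i: "i \<in> - J" "i' \<in> - J" "i \<noteq> i'"
        by (metis One_nat_def card_le_Suc0_iff_eq finite not_less_eq_eq numeral_2_eq_2)
      have "2 \<le> dim N"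
      proof -
        have "independent {axis i 1, axis i' 1 :: real ^ 'k}"
          by (rule independent_mono [OF independent_Basis]) (auto simp: axis_in_Basis_iff)
        moreover have "{axis i 1, axis i' 1} \<subseteq> N"
          using i by (auto simp: N_def axis_def)
        moreover have "card {axis i 1, axis i' 1 :: real ^ 'k} = 2"
          using i by (simp add: axis_eq_axis)
        ultimately show ?thesis
          using independent_card_le_dim by metis
      qed
      \<comment> \<open>The parts of the boundary where a further function vanishes. The update of
        \<tau> selects which function of pair \<open>j\<close> this is; the induction hypothesis
        makes each part compact.\<close>
      define K where "K = (\<Union>j\<in>-J. \<Union>\<epsilon>. H \<tau> ` region M h (insert j J) (\<tau>(j := \<epsilon>)))"
      have "compact K"
        unfolding K_def
      proof (intro compact_UN finite compact_continuous_image continuous_on_subset [OF contH])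
        show "compact (region M h (insert j J) (\<tau>(j := \<epsilon>)))" if "j \<in> - J" for j \<epsilon>
          using that by (intro less psubset_card_mono) auto
        show "region M h (insert j J) (\<tau>(j := \<epsilon>)) \<subseteq> M" for j \<epsilon>
          by (simp add: region_def)
      qed
      then obtain r where r: "r > 0" "\<And>z. z \<in> K \<Longrightarrow> norm z \<le> r"
        using compact_imp_bounded bounded_pos by metis
      define C where "C = {y \<in> N. norm y > r}"
      have C: "connected C"
        unfolding C_def using \<open>subspace N\<close> \<open>2 \<le> dim N\<close> r by (intro connected_subspace_outside_ball) auto
      \<comment> \<open>Outside the ball containing \<open>K\<close> no defining function vanishes
        on \<open>B\<close>, so weak and strict inequalities agree there. Hence
        \<open>C \<inter> B\<close> is open as well as closed in \<open>C\<close>.\<close>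
      have BC: "C \<inter> B = C \<inter> (\<Inter>j\<in>-J. \<Inter>\<epsilon>. {y. 0 < h j \<epsilon> (S \<tau> y)})"
      proof -
        have "h j \<epsilon> (S \<tau> y) \<noteq> 0" if y: "y \<in> C" "y \<in> B" and "j \<in> - J" for y j \<epsilon>
        proof
          assume "h j \<epsilon> (S \<tau> y) = 0"
          moreover have "y $ l = 0" if "l \<in> J" for l
            using y(2) that by (simp add: B_def N_def)
          ultimately have "S \<tau> y \<in> region M h (insert j J) (\<tau>(j := \<epsilon>))"
            using Bnonneg [OF y(2)] S(2) [of \<tau> y] by (auto simp: region_def hS)
          then have "H \<tau> (S \<tau> y) \<in> K"
            unfolding K_def using \<open>j \<in> - J\<close> by (intro UN_I [of j] UN_I [of \<epsilon>] imageI) auto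
          then have "y \<in> K" by (simp add: S(3))
          then show False using r(2) [of y] y by (auto simp: C_def)
        qed
        then have pos: "h j \<epsilon> (S \<tau> y) > 0" if "y \<in> C" "y \<in> B" "j \<in> - J" for y j \<epsilon>
          using Bnonneg [of y j \<epsilon>] that by (simp add: less_le)
        show ?thesis
        proof (rule set_eqI)
          fix y
          show "y \<in> C \<inter> B \<longleftrightarrow> y \<in> C \<inter> (\<Inter>j\<in>-J. \<Inter>\<epsilon>. {y. 0 < h j \<epsilon> (S \<tau> y)})"
            using pos [of y] by (auto simp: B_def C_def less_imp_le)
        qed
      qed
      have "openin (top_of_set C) (C \<inter> B)"
        unfolding BC
        by (intro openin_open_Int open_INT ballI open_Collect_less conthS continuous_on_const finite)
      moreover have "closedin (top_of_set C) (C \<inter> B)"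
        using \<open>closed B\<close> by (rule closedin_closed_Int)
      ultimately have "C \<inter> B = {} \<or> C \<inter> B = C"
        using C by (meson connected_clopen)
      \<comment> \<open>A point of \<open>C\<close> whose \<open>i\<close>-th coordinate, the value
        of \<open>h i (\<tau> i)\<close>, is negative; it excludes the case that \<open>B\<close>
        contains all of \<open>C\<close>.\<close>
      moreover have "axis i (- r - 1) \<in> C - B"
      proof -
        have "axis i (- r - 1) \<in> C"
          using i r by (simp add: C_def N_def norm_axis) (auto simp: axis_def)
        moreover have "h i (\<tau> i) (S \<tau> (axis i (- r - 1))) < 0"
          unfolding hS using r by simp
        then have "axis i (- r - 1) \<notin> B"
          using Bnonneg [OF _ i(1), of "axis i (- r - 1)" "\<tau> i"] by linarith
        ultimately show ?thesis by blast
      qed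
      ultimately have "C \<inter> B = {}" by blast
      then have "norm y \<le> r" if "y \<in> B" for y
        using that by (force simp: B_def C_def)
      then show ?thesis by (auto simp: bounded_iff)
    qed
  qed
  ultimately have "compact B" by (simp add: compact_eq_bounded_closed)
  then show ?case
    unfolding reg using S(1) by (intro compact_continuous_image continuous_on_subset [OF S(1)]) auto
qed

text \<open>A consequence of the intermediate value property. The sign is returned as a factor so
  that it can be multiplied into the function.\<close>

lemma connected_nonzero_constant_sign:
  fixes \<phi> :: "'a::topological_space \<Rightarrow> real"
  assumes "connected S" "continuous_on S \<phi>" "\<And>x. x \<in> S \<Longrightarrow> \<phi> x \<noteq> 0"
  shows "\<exists>c\<in>{1, -1}. \<forall>x\<in>S. c * \<phi> x > 0"
proof -
  have conn: "connected (\<phi> ` S)"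
    using assms by (intro connected_continuous_image)
  have "(\<forall>x\<in>S. \<phi> x > 0) \<or> (\<forall>x\<in>S. \<phi> x < 0)"
  proof (rule ccontr)
    assume "\<not> ?thesis"
    then obtain x y where "x \<in> S" "y \<in> S" "\<phi> x \<le> 0" "\<phi> y \<ge> 0" by (auto simp: not_less)
    then have "0 \<in> \<phi> ` S"
      using conn connected_contains_Icc [of "\<phi> ` S" "\<phi> x" "\<phi> y"] by auto
    then show False using assms(3) by auto
  qed
  then show ?thesis by auto
qed

theorem theorem1p1:
  fixes R :: "('f, 'r) expansion"
    and n :: nat
    and e :: "'k::finite \<Rightarrow> nat"
    and M :: "(nat \<Rightarrow> real) set"
    and f g :: "'k \<Rightarrow> (nat \<Rightarrow> real) \<Rightarrow> real"
  assumes "o_minimal R"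
    and "k_cell R n e M"
    and "\<And>i. definable_fun R n M (f i)" and "\<And>i. definable_fun R n M (g i)"
    and "\<And>i. C1_on_cell e M (f i)" and "\<And>i. C1_on_cell e M (g i)"
    and a: "\<And>\<tau>. regular_on_cell e M (H_map f g \<tau>)"
    and b: "\<And>\<tau>. proper_on M (H_map f g \<tau>)"
    and c: "\<And>i. connected {x \<in> M. f i x = 0}" "\<And>i. connected {x \<in> M. g i x = 0}"
    and d: "\<And>i. {x \<in> M. f i x = 0} \<inter> {x \<in> M. g i x = 0} = {}"
  shows "\<exists>sq :: 'k \<Rightarrow> bool \<Rightarrow> real \<Rightarrow> real \<Rightarrow> bool.
    (\<forall>i \<epsilon>. sq i \<epsilon> \<in> {(\<le>), (\<ge>)}) \<and>
    (\<forall>(J :: 'k set) (\<tau> :: 'k \<Rightarrow> bool).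
      compact {x \<in> M. (\<forall>i\<in>UNIV - J. sq i False (f i x) 0 \<and> sq i True (g i x) 0) \<and>
                       (\<forall>l\<in>J. h_fun f g l (\<tau> l) x = 0)}) \<and>
    compact {x \<in> M. \<forall>i. sq i False (f i x) 0 \<and> sq i True (g i x) 0}"
proof -
  let ?h = "h_fun f g"
  have H: "\<exists>s. homeomorphism M UNIV (H_map f g \<tau>) s" for \<tau>
    using proper_regular_on_cell_imp_homeomorphism [OF assms(2) a b] by blast
  have conth: "continuous_on M (?h i \<epsilon>)" for i \<epsilon>
  proof -
    have "continuous_on M (\<lambda>x. H_map f g (\<lambda>_. \<epsilon>) x $ i)"
      using H by (intro continuous_on_component) (auto simp: homeomorphism_def)
    then show ?thesis by (simp add: H_map_def)
  qed
  \<comment> \<open>The sign of each function on the zero set of its partner: constant because the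
    zero set is connected by (c), nonzero by (d).\<close>
  have "\<exists>c\<in>{1, -1}. \<forall>x\<in>{x \<in> M. ?h i (\<not> \<epsilon>) x = 0}. c * ?h i \<epsilon> x > 0" for i \<epsilon>
  proof (rule connected_nonzero_constant_sign)
    show "connected {x \<in> M. ?h i (\<not> \<epsilon>) x = 0}"
      using c [of i] by (simp add: h_fun_def)
    show "continuous_on {x \<in> M. ?h i (\<not> \<epsilon>) x = 0} (?h i \<epsilon>)"
      by (rule continuous_on_subset [OF conth]) auto
    show "?h i \<epsilon> x \<noteq> 0" if "x \<in> {x \<in> M. ?h i (\<not> \<epsilon>) x = 0}" for x
      using that d [of i] by (auto simp: h_fun_def split: if_splits)
  qed
  then obtain c where c: "\<And>i \<epsilon>. c i \<epsilon> \<in> {1, -1}"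
    and cpos: "\<And>i \<epsilon> x. \<lbrakk>x \<in> M; ?h i (\<not> \<epsilon>) x = 0\<rbrakk> \<Longrightarrow> c i \<epsilon> * ?h i \<epsilon> x > 0"
    by (metis (mono_tags, lifting) mem_Collect_eq)
  have c0: "c i \<epsilon> \<noteq> 0" and c1: "c i \<epsilon> * (c i \<epsilon> * y) = y" for i \<epsilon> and y :: real
    using c [of i \<epsilon>] by auto
  define h where "h i \<epsilon> x = c i \<epsilon> * ?h i \<epsilon> x" for i \<epsilon> x
  have compact: "compact (region M h J \<tau>)" for J \<tau>
  proof (rule compact_region)
    fix \<tau> :: "'k \<Rightarrow> bool"
    obtain s where s: "homeomorphism M UNIV (H_map f g \<tau>) s" using H ..
    \<comment> \<open>Multiplying the coordinates by signs is a self-inverse homeomorphism of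
      \<open>\<real>\<^sup>k\<close>, so the normalised maps are again homeomorphisms.\<close>
    let ?\<delta> = "\<lambda>y :: real ^ 'k. \<chi> i. c i (\<tau> i) * y $ i"
    have \<delta>: "homeomorphism UNIV UNIV ?\<delta> ?\<delta>"
      by (rule homeomorphismI) (auto simp: c1 intro!: continuous_intros)
    have "homeomorphism M UNIV (\<lambda>x. \<chi> i. h i (\<tau> i) x) (s \<circ> ?\<delta>)"
      using homeomorphism_compose [OF s \<delta>]
      by (rule homeomorphism_cong) (auto simp: h_def H_map_def)
    then show "\<exists>s. homeomorphism M UNIV (\<lambda>x. \<chi> i. h i (\<tau> i) x) s" by blast
  next
    fix i \<epsilon> x assume "x \<in> M" "h i (\<not> \<epsilon>) x = 0"
    then show "h i \<epsilon> x > 0"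
      using cpos c0 by (simp add: h_def)
  qed
  \<comment> \<open>A positive factor calls for \<open>\<ge>\<close> and a negative one for
    \<open>\<le>\<close>, so that the normalised inequality is always nonnegativity.\<close>
  define sq :: "'k \<Rightarrow> bool \<Rightarrow> real \<Rightarrow> real \<Rightarrow> bool"
    where "sq i \<epsilon> = (if c i \<epsilon> = 1 then (\<ge>) else (\<le>))" for i \<epsilon>
  have sq: "sq i \<epsilon> y 0 \<longleftrightarrow> c i \<epsilon> * y \<ge> 0" for i \<epsilon> y
    using c [of i \<epsilon>] by (auto simp: sq_def)
  have region: "{x \<in> M. (\<forall>i\<in>UNIV - J. sq i False (f i x) 0 \<and> sq i True (g i x) 0) \<and>
      (\<forall>l\<in>J. ?h l (\<tau> l) x = 0)} = region M h J \<tau>" for J \<tau>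
    by (auto simp: region_def sq h_def c0 all_bool_eq h_fun_def)
  \<comment> \<open>With \<open>J\<close> empty no equation is imposed, so any \<tau> may be
    supplied; constantly \<open>False\<close> is a default.\<close>
  have "{x \<in> M. \<forall>i. sq i False (f i x) 0 \<and> sq i True (g i x) 0} = region M h {} (\<lambda>_. False)"
    by (auto simp: region_def sq h_def all_bool_eq h_fun_def)
  then show ?thesis
    using compact region by (intro exI [of _ sq]) (auto simp: sq_def)
qed

end
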